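(* Let $S$ be a pure $n$-dimensional finite relative simplicial complex and $\tau$ an $h$-tiling of $S$. Then $$\sum_{k=0}^{n+1} h_k(\tau)X^k(X+1)^{n+1-k}=X\sum_{k=0}^{n} f_k(S)X^k+\sum_{k=0}^{n-1}c_k(\tau)X^k.$$ In particular, two $h$-tilings of $S$ have the same $h$-vector if and only if they have the same $c$-vector.
   Context: A finite relative simplicial complex $S=K\setminus L$ consists of a finite simplicial complex $K$ and a subcomplex $L$ containing no maximal simplex of $K$; $|S|=|K|\setminus|L|$; it is pure $n$-dimensional if all maximal simplices of $K$ have dimension $n$. $f_k(S)$ is the number of $k$-dimensional simplices of $K$ not belonging to $L$. A relative simplex is a simplex deprived of some proper faces. A basic tile of dimension $n$ and order $k\in\{0,\dots,n+1\}$ is an $n$-simplex deprived of $k$ of its $(n-1)$-faces; it has a unique face of least dimension $k-1$. A critical tile of dimension $n$ and index $k\in\{0,\dots,n\}$ is a basic tile of order $k$ deprived moreover of that $(k-1)$-dimensional face; its order is defined to be $k$ if $k<n$ and $n+1$ if $k=n$ (it is then the open simplex). An $h$-tiling of $S$ is a partition of $|S|$ into basic or critical tiles whose underlying simplices are simplices of $K$, such that for every $d\ge0$ the union of tiles of dimension $>d$ is closed in $|S|$. Its $h$-vector is $h(\tau)=(h_0(\tau),\dots,h_{n+1}(\tau))$ with $h_j(\tau)$ the number of tiles of order $j$ (counting critical tiles as well), and its $c$-vector is $c(\tau)=(c_0(\tau),\dots,c_n(\tau))$ with $c_j(\tau)$ the number of critical tiles of index $j$. *)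

theory Defs
  imports "HOL-Analysis.Analysis" "HOL-Computational_Algebra.Polynomial"
begin

(* Complexes are geometric, in an arbitrary Euclidean space.  In the library, a nonempty
   simplicial complex contains the empty simplex, of dimension -1. *)

definition maximal_simplex :: "'a::euclidean_space set set \<Rightarrow> 'a set \<Rightarrow> bool"
  where "maximal_simplex K \<sigma> \<longleftrightarrow> \<sigma> \<in> K \<and> (\<forall>\<sigma>'\<in>K. \<sigma> \<subseteq> \<sigma>' \<longrightarrow> \<sigma>' = \<sigma>)"

definition relative_complex :: "'a::euclidean_space set set \<Rightarrow> 'a set set \<Rightarrow> bool"
  where "relative_complex K L \<longleftrightarrow>
    simplicial_complex K \<and> simplicial_complex L \<and> L \<subseteq> K \<and> (\<forall>\<sigma>. maximal_simplex K \<sigma> \<longrightarrow> \<sigma> \<notin> L)"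

definition pure_dim :: "nat \<Rightarrow> 'a::euclidean_space set set \<Rightarrow> bool"
  where "pure_dim n K \<longleftrightarrow> (\<forall>\<sigma>. maximal_simplex K \<sigma> \<longrightarrow> int n simplex \<sigma>)"

definition support :: "'a::euclidean_space set set \<Rightarrow> 'a set set \<Rightarrow> 'a set"
  where "support K L = \<Union>K - \<Union>L"

definition f_num :: "'a::euclidean_space set set \<Rightarrow> 'a set set \<Rightarrow> nat \<Rightarrow> nat"
  where "f_num K L k = card {\<sigma> \<in> K - L. int k simplex \<sigma>}"

text \<open>
  The empty set is admitted as a face, of dimension \<open>-1\<close>: it is the only proper face of a
  \<open>0\<close>-simplex (so orders \<open>0\<close> and \<open>1\<close> both exist in dimension \<open>0\<close>), and it is the
  \<open>(k-1)\<close>-dimensional face removed from a critical tile of index \<open>k = 0\<close>.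
\<close>

definition codim1_faces :: "nat \<Rightarrow> 'a::euclidean_space set \<Rightarrow> 'a set set"
  where "codim1_faces n \<sigma> = {F. F face_of \<sigma> \<and> (int n - 1) simplex F}"

definition basic_tile :: "'a::euclidean_space set \<Rightarrow> nat \<Rightarrow> nat \<Rightarrow> 'a set \<Rightarrow> bool"
  where "basic_tile \<sigma> n k T \<longleftrightarrow>
    int n simplex \<sigma> \<and> (\<exists>\<F> \<subseteq> codim1_faces n \<sigma>. card \<F> = k \<and> T = \<sigma> - \<Union>\<F>)"

(* A face G of \<sigma> remains a face of the basic tile iff it lies in none of the removed faces;
   the conditions below single out the face of least dimension of the basic tile. *)

definition critical_tile :: "'a::euclidean_space set \<Rightarrow> nat \<Rightarrow> nat \<Rightarrow> 'a set \<Rightarrow> bool"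
  where "critical_tile \<sigma> n k T \<longleftrightarrow>
    int n simplex \<sigma> \<and> k \<le> n \<and>
    (\<exists>\<F> \<subseteq> codim1_faces n \<sigma>. card \<F> = k \<and>
      (\<exists>G. G face_of \<sigma> \<and> (int k - 1) simplex G \<and> (\<forall>F\<in>\<F>. \<not> G \<subseteq> F) \<and> T = \<sigma> - \<Union>\<F> - G))"

definition tile :: "'a::euclidean_space set \<Rightarrow> nat \<Rightarrow> 'a set \<Rightarrow> bool"
  where "tile \<sigma> n T \<longleftrightarrow> (\<exists>k. basic_tile \<sigma> n k T \<or> critical_tile \<sigma> n k T)"

text \<open>
  As point sets, the critical tile of index \<open>0\<close> is the closed simplex, and that of index \<open>n\<close> is
  the open one, so these are also basic tiles, of orders \<open>0\<close> and \<open>n + 1\<close>.  For \<open>n > 0\<close> the two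
  definitions of the order agree.  A point (\<open>n = 0\<close>) is a basic tile of order \<open>0\<close> and of
  order \<open>1\<close>, and a critical tile of index \<open>0 = n\<close>; the rule for critical tiles is given
  precedence, whence order \<open>1\<close>.
\<close>

definition has_order :: "'a::euclidean_space set \<Rightarrow> nat \<Rightarrow> bool"
  where "has_order T j \<longleftrightarrow>
    (if \<exists>\<sigma> n k. critical_tile \<sigma> n k T
     then \<exists>\<sigma> n k. critical_tile \<sigma> n k T \<and> j = (if k < n then k else n + 1)
     else \<exists>\<sigma> n. basic_tile \<sigma> n j T)"

definition h_tiling :: "'a::euclidean_space set set \<Rightarrow> 'a set set \<Rightarrow> 'a set set \<Rightarrow> bool"
  where "h_tiling K L \<tau> \<longleftrightarrow>
    partition_on (support K L) \<tau> \<and>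
    (\<forall>T\<in>\<tau>. \<exists>\<sigma>\<in>K. \<exists>n. tile \<sigma> n T) \<and>
    (\<forall>d. closedin (top_of_set (support K L)) (\<Union>{T \<in> \<tau>. \<exists>\<sigma> n. d < n \<and> tile \<sigma> n T}))"

definition h_num :: "'a::euclidean_space set set \<Rightarrow> nat \<Rightarrow> nat"
  where "h_num \<tau> j = card {T \<in> \<tau>. has_order T j}"

definition c_num :: "'a::euclidean_space set set \<Rightarrow> nat \<Rightarrow> nat"
  where "c_num \<tau> j = card {T \<in> \<tau>. \<exists>\<sigma> n. critical_tile \<sigma> n j T}"

end

(*
Every simplex of K outside L has its relative interior in exactly one tile T, and is then a
face of the closed simplex underlying T; closedness of the unions of tiles forces all tiles to be
n-dimensional. The faces of a basic tile of order k correspond to the vertex sets containing k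
fixed vertices, so, with a face on m vertices weighted X^m, they contribute X^k (X+1)^(n+1-k).
In a critical tile of index k the term X^k is missing. Summing over tiles gives the identity.
The polynomials X^k (X+1)^(n+1-k) are linearly independent, so the c-vector determines the
h-vector; conversely the identity gives c_k for k < n, and c_n = h_(n+1).
*)
theory Submission
  imports Defs
begin

section \<open>Affine independence and weighted counts of vertex sets\<close>

text \<open>A point of \<open>A\<close> outside \<open>B\<close> would lie in the affine hull of the
  other points of \<open>C\<close>. This lets inclusions between faces be read off their vertex
  sets.\<close>

lemma convex_hull_subset_iff_affine_independent:
  assumes "\<not> affine_dependent C" "A \<subseteq> C" "B \<subseteq> C"
  shows "convex hull A \<subseteq> convex hull B \<longleftrightarrow> A \<subseteq> B"
proof
  assume *: "convex hull A \<subseteq> convex hull B"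
  show "A \<subseteq> B"
  proof
    fix x assume "x \<in> A"
    then have "x \<in> convex hull B"
      using * hull_subset by fastforce
    then have "x \<in> affine hull B"
      using convex_hull_subset_affine_hull by auto
    moreover have "affine hull B \<subseteq> affine hull (C - {x})" if "x \<notin> B"
      using that assms(3) by (intro hull_mono) auto
    ultimately show "x \<in> B"
      using assms \<open>x \<in> A\<close> unfolding affine_dependent_def by blast
  qed
qed (rule hull_mono)

text \<open>Writing \<open>A = B \<union> D\<close> with \<open>D\<close> disjoint from
  \<open>B\<close> leaves a binomial expansion over the subsets of \<open>C - B\<close>.\<close>

lemma sum_power_card_between:
  fixes x :: "'b::comm_semiring_1"
  assumes "finite C" "B \<subseteq> C"
  shows "(\<Sum>A | B \<subseteq> A \<and> A \<subseteq> C. x ^ card A) = x ^ card B * (x + 1) ^ (card C - card B)"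
proof -
  have fB: "finite B" using assms finite_subset by auto
  have "(\<Sum>A | B \<subseteq> A \<and> A \<subseteq> C. x ^ card A) = (\<Sum>D\<in>Pow (C - B). x ^ card (B \<union> D))"
    by (rule sum.reindex_bij_witness[where i = "\<lambda>D. B \<union> D" and j = "\<lambda>A. A - B"])
       (use assms in \<open>auto simp: Un_absorb1\<close>)
  also have "\<dots> = (\<Sum>D\<in>Pow (C - B). x ^ card B * x ^ card D)"
  proof (rule sum.cong)
    fix D assume "D \<in> Pow (C - B)"
    then have "card (B \<union> D) = card B + card D"
      using assms fB by (intro card_Un_disjoint) (auto intro: finite_subset)
    then show "x ^ card (B \<union> D) = x ^ card B * x ^ card D"
      by (simp add: power_add)
  qed simp
  \<comment> \<open>Expanding the product picks \<open>x\<close> on \<open>D\<close> and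
    \<open>1\<close> on the rest of \<open>C - B\<close>.\<close>
  also have "\<dots> = x ^ card B * (\<Prod>c\<in>C - B. x + 1)"
    using assms by (subst prod_add) (auto simp: sum_distrib_left)
  finally show ?thesis
    using assms fB by (simp add: card_Diff_subset)
qed

section \<open>Open cells of a simplex deprived of faces\<close>

text \<open>The closed simplex underlying a tile is recovered as \<open>closure T\<close>, so the
  cells depend on the point set alone. The empty face is excluded by hand, since its relative
  interior lies in every set.\<close>

definition cells :: "'a::euclidean_space set \<Rightarrow> 'a set set"
  where "cells T = {\<rho>. \<rho> face_of closure T \<and> \<rho> \<noteq> {} \<and> rel_interior \<rho> \<subseteq> T}"

text \<open>The exponent is the number of vertices, one more than the dimension. At
  \<open>x = 1\<close> the cells are counted.\<close>

definition cell_poly :: "'a::euclidean_space set \<Rightarrow> 'b::comm_ring_1 \<Rightarrow> 'b"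
  where "cell_poly T x = (\<Sum>\<rho>\<in>cells T. x ^ nat (aff_dim \<rho> + 1))"

lemma face_disjoint_rel_interior:
  fixes S :: "'a::real_normed_vector set"
  assumes "G face_of S" "\<rho> face_of S" "\<not> \<rho> \<subseteq> G"
  shows "rel_interior \<rho> \<inter> G = {}"
  using subset_of_face_of[OF assms(1) face_of_imp_subset[OF assms(2)]] assms(3) by blast

text \<open>The common form of basic and critical tiles: proper faces, given by their vertex sets in
  \<open>\<A>\<close>, are removed. The relative interior of a face misses \<open>T\<close> if the
  face is contained in a removed one and lies in \<open>T\<close> otherwise, so meeting
  \<open>T\<close> there is enough to be a cell. As all removed faces are proper, the open simplex
  survives, and it is dense.\<close>

lemma punctured_simplex:
  fixes C :: "'a::euclidean_space set"
  assumes C: "\<not> affine_dependent C"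
    and \<A>: "\<And>A. A \<in> \<A> \<Longrightarrow> A \<subset> C"
  defines "T \<equiv> convex hull C - (\<Union>A\<in>\<A>. convex hull A)"
  shows closure_punctured: "closure T = convex hull C"
    and rel_interior_punctured: "rel_interior (convex hull C) \<subseteq> T"
    and cells_punctured:
      "cells T = (\<lambda>A. convex hull A) ` {A. A \<subseteq> C \<and> A \<noteq> {} \<and> (\<forall>A'\<in>\<A>. \<not> A \<subseteq> A')}"
    and cells_cover_punctured: "\<And>\<rho>. \<rho> face_of convex hull C \<Longrightarrow> rel_interior \<rho> \<inter> T \<noteq> {} \<Longrightarrow> \<rho> \<in> cells T"
proof -
  let ?h = "\<lambda>A::'a set. convex hull A"
  have face: "?h A face_of ?h C" if "A \<subseteq> C" for A
    using that face_of_convex_hull_affine_independent[OF C] by blast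
  have sub: "?h A \<subseteq> ?h B \<longleftrightarrow> A \<subseteq> B" if "A \<subseteq> C" "B \<subseteq> C" for A B
    using convex_hull_subset_iff_affine_independent[OF C] that by blast
  have relint: "rel_interior (?h A) \<inter> ?h B = {}" if "A \<subseteq> C" "B \<subseteq> C" "\<not> A \<subseteq> B" for A B
    using face_disjoint_rel_interior[OF face face, of B A] sub[of A B] that by simp
  show int: "rel_interior (?h C) \<subseteq> T"
  proof -
    have "rel_interior (?h C) \<inter> ?h A = {}" if "A \<in> \<A>" for A
      using relint[of C A] \<A>[OF that] by blast
    then show ?thesis
      using rel_interior_subset[of "?h C"] unfolding T_def by blast
  qed
  show cl: "closure T = ?h C"
  proof
    have "closed (?h C)"
      using C aff_independent_finite finite_imp_compact_convex_hull compact_imp_closed by blast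
    then show "closure T \<subseteq> ?h C"
      by (simp add: T_def closure_minimal)
    show "?h C \<subseteq> closure T"
      using closure_mono[OF int] convex_closure_rel_interior[of "?h C"] closure_subset by auto
  qed
  have relin: "rel_interior (?h A) \<subseteq> T" if "A \<subseteq> C" "\<forall>A'\<in>\<A>. \<not> A \<subseteq> A'" for A
  proof -
    have "rel_interior (?h A) \<inter> ?h A' = {}" if "A' \<in> \<A>" for A'
      using relint[of A A'] \<A>[OF that] that \<open>A \<subseteq> C\<close> \<open>\<forall>A'\<in>\<A>. \<not> A \<subseteq> A'\<close> by blast
    then show ?thesis
      using rel_interior_subset[of "?h A"] hull_mono[OF \<open>A \<subseteq> C\<close>, of convex] unfolding T_def by blast
  qed
  have relout: "rel_interior (?h A) \<inter> T = {}" if "A' \<in> \<A>" "A \<subseteq> A'" for A A'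
    using that rel_interior_subset[of "?h A"] hull_mono[OF \<open>A \<subseteq> A'\<close>, of convex] unfolding T_def by blast
  have ne: "rel_interior (?h A) \<noteq> {}" if "A \<noteq> {}" for A
    using that rel_interior_eq_empty[of "?h A"] by simp
  show cells: "cells T = ?h ` {A. A \<subseteq> C \<and> A \<noteq> {} \<and> (\<forall>A'\<in>\<A>. \<not> A \<subseteq> A')}" (is "_ = ?h ` ?R")
  proof (intro subset_antisym subsetI)
    fix \<rho> assume "\<rho> \<in> cells T"
    then obtain A where A: "A \<subseteq> C" "\<rho> = ?h A" "A \<noteq> {}" "rel_interior (?h A) \<subseteq> T"
      unfolding cells_def cl face_of_convex_hull_affine_independent[OF C] mem_Collect_eq
      by (metis convex_hull_eq_empty)
    have "\<not> A \<subseteq> A'" if "A' \<in> \<A>" for A'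
      using relout[of A' A] that ne[of A] A by blast
    then have "A \<in> ?R"
      using A by simp
    then show "\<rho> \<in> ?h ` ?R" using A by blast
  next
    fix \<rho> assume "\<rho> \<in> ?h ` ?R"
    then show "\<rho> \<in> cells T"
      unfolding cells_def cl using face relin by auto
  qed
  show "\<rho> \<in> cells T" if \<rho>: "\<rho> face_of ?h C" "rel_interior \<rho> \<inter> T \<noteq> {}" for \<rho>
  proof -
    obtain A where A: "A \<subseteq> C" "\<rho> = ?h A"
      using \<rho> face_of_convex_hull_affine_independent[OF C] by auto
    moreover have "A \<noteq> {}" using \<rho> A by auto
    moreover have "\<not> A \<subseteq> A'" if "A' \<in> \<A>" for A'
      using relout[of A' A] that \<rho> A by auto
    ultimately have "A \<in> ?R" by simp
    then show ?thesis unfolding cells A(2) by (rule imageI)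
  qed
qed

text \<open>Distinct subsets of \<open>C\<close> span distinct faces, and the exponent of a face is
  its number of vertices.\<close>

lemma sum_over_hulls:
  assumes C: "\<not> affine_dependent C" and R: "R \<subseteq> Pow C"
  shows "(\<Sum>\<rho>\<in>(\<lambda>A. convex hull A) ` R. x ^ nat (aff_dim \<rho> + 1)) = (\<Sum>A\<in>R. x ^ card A)"
proof -
  have "inj_on (\<lambda>A. convex hull A) R"
    using convex_hull_subset_iff_affine_independent[OF C] R
    by (intro inj_onI) (metis PowD equalityE subset_antisym subset_iff)
  moreover have "nat (aff_dim (convex hull A) + 1) = card A" if "A \<in> R" for A
    using aff_dim_affine_independent[of A] affine_independent_subset[OF C] R that
    by (metis PowD aff_dim_convex_hull nat_int subset_iff)
  ultimately show ?thesis
    by (simp add: sum.reindex)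
qed

section \<open>Facets of a simplex and vertex descriptions of tiles\<close>

text \<open>A face of dimension \<open>n - 1\<close> has \<open>n\<close> of the
  \<open>n + 1\<close> vertices, so it is opposite to the one it misses. For \<open>n = 0\<close> it
  is the empty face.\<close>

lemma codim1_faces_simplex:
  assumes C: "\<not> affine_dependent C" and n: "card C = n + 1"
  shows "codim1_faces n (convex hull C) = (\<lambda>v. convex hull (C - {v})) ` C"
proof (intro subset_antisym subsetI)
  fix F assume "F \<in> codim1_faces n (convex hull C)"
  then obtain A where A: "A \<subseteq> C" "F = convex hull A" "aff_dim F = int n - 1"
    unfolding codim1_faces_def face_of_convex_hull_affine_independent[OF C]
    using aff_dim_simplex by blast
  then have "int (card A) = n"
    using aff_dim_affine_independent[of A] affine_independent_subset[OF C]
    by (simp add: aff_dim_convex_hull)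
  then have "card (C - A) = 1"
    using A n card_Diff_subset[of A C] aff_independent_finite[OF C] finite_subset[of A C] by auto
  then obtain v where "C - A = {v}"
    using card_1_singletonE by blast
  then have "v \<in> C" "A = C - {v}" using A by auto
  then show "F \<in> (\<lambda>v. convex hull (C - {v})) ` C" using A by blast
next
  fix F assume "F \<in> (\<lambda>v. convex hull (C - {v})) ` C"
  then obtain v where v: "v \<in> C" "F = convex hull (C - {v})" by blast
  then have "card (C - {v}) = n"
    using n by simp
  moreover have "\<not> affine_dependent (C - {v})"
    using affine_independent_subset[OF C] by blast
  ultimately have "(int n - 1) simplex F"
    using v unfolding simplex_def by auto
  then show "F \<in> codim1_faces n (convex hull C)"
    unfolding codim1_faces_def face_of_convex_hull_affine_independent[OF C] using v by blast
qed

lemma inj_on_facet_opposite: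
  assumes C: "\<not> affine_dependent C"
  shows "inj_on (\<lambda>v. convex hull (C - {v})) C"
proof (rule inj_onI)
  fix v w assume "v \<in> C" "w \<in> C" "convex hull (C - {v}) = convex hull (C - {w})"
  then have "C - {v} \<subseteq> C - {w}"
    using convex_hull_subset_iff_affine_independent[OF C, of "C - {v}" "C - {w}"] by auto
  with \<open>w \<in> C\<close> show "v = w" by blast
qed

text \<open>Facets are encoded injectively by their opposite vertices, so \<open>k\<close> facets
  give \<open>k\<close> vertices.\<close>

lemma facets_eq_image:
  assumes C: "\<not> affine_dependent C" and n: "card C = n + 1"
    and \<F>: "\<F> \<subseteq> codim1_faces n (convex hull C)" "card \<F> = k"
  obtains B where "B \<subseteq> C" "card B = k" "\<F> = (\<lambda>v. convex hull (C - {v})) ` B"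
proof -
  obtain B where B: "B \<subseteq> C" "\<F> = (\<lambda>v. convex hull (C - {v})) ` B"
    using \<F> unfolding codim1_faces_simplex[OF C n] subset_image_iff by blast
  then have "card B = k"
    using \<F>(2) card_image[OF inj_on_subset[OF inj_on_facet_opposite[OF C] B(1)]] by simp
  with B that show ?thesis by blast
qed

text \<open>\<open>B\<close> consists of the vertices opposite to the removed facets; the faces that
  remain are those whose vertices include \<open>B\<close>.\<close>

lemma basic_tileE:
  assumes "basic_tile \<sigma> n k T"
  obtains C B where "\<not> affine_dependent C" "card C = n + 1" "\<sigma> = convex hull C"
    "B \<subseteq> C" "card B = k" "T = convex hull C - (\<Union>A\<in>(\<lambda>v. C - {v}) ` B. convex hull A)"
proof -
  from assms obtain C where C: "\<not> affine_dependent C" "card C = n + 1" "\<sigma> = convex hull C"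
    unfolding basic_tile_def simplex_def by auto
  from assms obtain \<F> where \<F>: "\<F> \<subseteq> codim1_faces n \<sigma>" "card \<F> = k" "T = \<sigma> - \<Union>\<F>"
    unfolding basic_tile_def by auto
  obtain B where "B \<subseteq> C" "card B = k" "\<F> = (\<lambda>v. convex hull (C - {v})) ` B"
    using facets_eq_image C \<F> by blast
  with C \<F> show ?thesis by (intro that[of C B]) auto
qed

text \<open>A face in none of the removed facets contains all their opposite vertices
  \<open>B\<close>; having only \<open>k\<close> vertices, it is the hull of \<open>B\<close>
  itself. Since \<open>k \<le> n\<close>, it is a proper face.\<close>

lemma critical_tileE:
  assumes "critical_tile \<sigma> n k T"
  obtains C B where "\<not> affine_dependent C" "card C = n + 1" "\<sigma> = convex hull C"
    "B \<subset> C" "card B = k"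
    "T = convex hull C - (\<Union>A\<in>insert B ((\<lambda>v. C - {v}) ` B). convex hull A)"
proof -
  from assms obtain C where C: "\<not> affine_dependent C" "card C = n + 1" "\<sigma> = convex hull C"
    unfolding critical_tile_def simplex_def by auto
  from assms obtain \<F> G where \<F>: "\<F> \<subseteq> codim1_faces n \<sigma>" "card \<F> = k" "T = \<sigma> - \<Union>\<F> - G"
    and G: "G face_of \<sigma>" "(int k - 1) simplex G" "\<forall>F\<in>\<F>. \<not> G \<subseteq> F" and k: "k \<le> n"
    unfolding critical_tile_def by auto
  obtain B where B: "B \<subseteq> C" "card B = k" "\<F> = (\<lambda>v. convex hull (C - {v})) ` B"
    using facets_eq_image C \<F> by blast
  obtain D where D: "D \<subseteq> C" "G = convex hull D"
    using G(1) unfolding C(3) face_of_convex_hull_affine_independent[OF C(1)] by blast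
  then have cD: "card D = k"
    using aff_dim_affine_independent[of D] affine_independent_subset[OF C(1)] aff_dim_simplex[OF G(2)]
    by (simp add: aff_dim_convex_hull)
  have "B \<subseteq> D"
  proof
    fix v assume "v \<in> B"
    then have "\<not> convex hull D \<subseteq> convex hull (C - {v})"
      using G D B by blast
    then show "v \<in> D"
      using D hull_mono[of D "C - {v}" convex] by blast
  qed
  then have "B = D"
    using cD B(2) D(1) aff_independent_finite[OF C(1)] by (metis card_subset_eq finite_subset)
  moreover have "B \<noteq> C" using B k C by auto
  ultimately show ?thesis using C \<F> B D by (intro that[of C B]) auto
qed

section \<open>Cell polynomials of the two kinds of tiles\<close>

text \<open>The vertex sets of the cells are those between \<open>B\<close> and \<open>C\<close>
  except the empty set, which lies between them only for order \<open>0\<close>. This accounts for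
  the correction \<open>1\<close>.\<close>

lemma cell_poly_basic:
  fixes x :: "'b::comm_ring_1"
  assumes "basic_tile \<sigma> n k T"
  shows "cell_poly T x = x ^ k * (x + 1) ^ (n + 1 - k) - (if k = 0 then 1 else 0)"
proof -
  obtain C B where CB: "\<not> affine_dependent C" "card C = n + 1" "\<sigma> = convex hull C"
    "B \<subseteq> C" "card B = k" "T = convex hull C - (\<Union>A\<in>(\<lambda>v. C - {v}) ` B. convex hull A)"
    using basic_tileE[OF assms] .
  have fin: "finite C" "finite B" using CB aff_independent_finite finite_subset by metis+
  define R where "R = {A. A \<subseteq> C \<and> A \<noteq> {} \<and> (\<forall>A'\<in>(\<lambda>v. C - {v}) ` B. \<not> A \<subseteq> A')}"
  have "cells T = (\<lambda>A. convex hull A) ` R"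
    unfolding CB(6) R_def by (rule cells_punctured) (use CB in auto)
  then have "cell_poly T x = (\<Sum>A\<in>R. x ^ card A)"
    unfolding cell_poly_def using sum_over_hulls[OF CB(1), of R x] by (auto simp: R_def)
  also have "R = {A. B \<subseteq> A \<and> A \<subseteq> C} - {{}}"
    unfolding R_def using CB by auto
  also have "(\<Sum>A\<in>{A. B \<subseteq> A \<and> A \<subseteq> C} - {{}}. x ^ card A) =
    (\<Sum>A | B \<subseteq> A \<and> A \<subseteq> C. x ^ card A) - (if k = 0 then 1 else 0)"
  proof -
    have "finite {A. B \<subseteq> A \<and> A \<subseteq> C}" using fin by simp
    moreover have "B = {} \<longleftrightarrow> k = 0" using CB fin by auto
    ultimately show ?thesis by (subst sum_diff1) auto
  qed
  finally show ?thesis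
    using sum_power_card_between[OF fin(1) CB(4), of x] CB by simp
qed

text \<open>Removing the face spanned by \<open>B\<close> discards only \<open>B\<close> among the
  vertex sets between \<open>B\<close> and \<open>C\<close>. For \<open>k = 0\<close> this is the
  empty set, so no separate correction arises.\<close>

lemma cell_poly_critical:
  fixes x :: "'b::comm_ring_1"
  assumes "critical_tile \<sigma> n k T"
  shows "cell_poly T x = x ^ k * (x + 1) ^ (n + 1 - k) - x ^ k"
proof -
  obtain C B where CB: "\<not> affine_dependent C" "card C = n + 1" "\<sigma> = convex hull C"
    "B \<subset> C" "card B = k"
    "T = convex hull C - (\<Union>A\<in>insert B ((\<lambda>v. C - {v}) ` B). convex hull A)"
    using critical_tileE[OF assms] .
  have fin: "finite C" "finite B" using CB aff_independent_finite finite_subset by (metis psubset_imp_subset)+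
  define R where "R = {A. A \<subseteq> C \<and> A \<noteq> {} \<and> (\<forall>A'\<in>insert B ((\<lambda>v. C - {v}) ` B). \<not> A \<subseteq> A')}"
  have "cells T = (\<lambda>A. convex hull A) ` R"
    unfolding CB(6) R_def by (rule cells_punctured) (use CB in auto)
  then have "cell_poly T x = (\<Sum>A\<in>R. x ^ card A)"
    unfolding cell_poly_def using sum_over_hulls[OF CB(1), of R x] by (auto simp: R_def)
  also have "R = {A. B \<subseteq> A \<and> A \<subseteq> C} - {B}"
    unfolding R_def using CB by auto
  also have "(\<Sum>A\<in>{A. B \<subseteq> A \<and> A \<subseteq> C} - {B}. x ^ card A) =
    (\<Sum>A | B \<subseteq> A \<and> A \<subseteq> C. x ^ card A) - x ^ k"
  proof -
    have "finite {A. B \<subseteq> A \<and> A \<subseteq> C}" using fin by simp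
    then show ?thesis using CB by (subst sum_diff1) auto
  qed
  finally show ?thesis
    using sum_power_card_between[OF fin(1), of B x] CB by auto
qed

text \<open>Both kinds of tiles are punctured simplices, so later arguments need not look at the
  kind. By the last property, a single point of its relative interior decides that a face is a
  cell.\<close>

lemma tile_simplex:
  assumes "tile \<sigma> n T"
  shows "int n simplex \<sigma>" "closure T = \<sigma>" "rel_interior \<sigma> \<subseteq> T" "T \<subseteq> \<sigma>"
    and "\<And>\<rho>. \<rho> face_of \<sigma> \<Longrightarrow> rel_interior \<rho> \<inter> T \<noteq> {} \<Longrightarrow> \<rho> \<in> cells T"
proof -
  obtain k where k: "basic_tile \<sigma> n k T \<or> critical_tile \<sigma> n k T"
    using assms unfolding tile_def by blast
  then show "int n simplex \<sigma>"
    by (auto simp: basic_tile_def critical_tile_def)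
  obtain C \<A> where CA: "\<not> affine_dependent C" "\<sigma> = convex hull C" "\<And>A. A \<in> \<A> \<Longrightarrow> A \<subset> C"
    "T = convex hull C - (\<Union>A\<in>\<A>. convex hull A)"
    using k
  proof
    assume "basic_tile \<sigma> n k T"
    then obtain C B where *: "\<not> affine_dependent C" "card C = n + 1" "\<sigma> = convex hull C"
      "B \<subseteq> C" "card B = k" "T = convex hull C - (\<Union>A\<in>(\<lambda>v. C - {v}) ` B. convex hull A)"
      by (rule basic_tileE)
    show ?thesis by (rule that[of C "(\<lambda>v. C - {v}) ` B"]) (use * in auto)
  next
    assume "critical_tile \<sigma> n k T"
    then obtain C B where *: "\<not> affine_dependent C" "card C = n + 1" "\<sigma> = convex hull C"
      "B \<subset> C" "card B = k"
      "T = convex hull C - (\<Union>A\<in>insert B ((\<lambda>v. C - {v}) ` B). convex hull A)"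
      by (rule critical_tileE)
    show ?thesis by (rule that[of C "insert B ((\<lambda>v. C - {v}) ` B)"]) (use * in auto)
  qed
  show "closure T = \<sigma>"
    unfolding CA(2,4) by (rule closure_punctured[OF CA(1,3)])
  show "rel_interior \<sigma> \<subseteq> T"
    unfolding CA(2,4) by (rule rel_interior_punctured[OF CA(1,3)])
  show "\<rho> \<in> cells T" if "\<rho> face_of \<sigma>" "rel_interior \<rho> \<inter> T \<noteq> {}" for \<rho>
    using cells_cover_punctured[of C \<A>, OF CA(1)] CA(3) that unfolding CA(2,4) by metis
  show "T \<subseteq> \<sigma>" using CA by auto
qed

section \<open>Uniqueness of dimension, index and order\<close>

text \<open>The closure of the tile recovers the simplex, hence its dimension.\<close>

lemma tile_unique:
  assumes "tile \<sigma> n T" "tile \<sigma>' n' T"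
  shows "\<sigma>' = \<sigma>" "n' = n"
proof -
  show "\<sigma>' = \<sigma>"
    using assms tile_simplex(2) by metis
  then have "int n = int n'"
    using assms tile_simplex(1) aff_dim_simplex by metis
  then show "n' = n" by simp
qed

text \<open>The number of cells, which is \<open>cell_poly\<close> at \<open>1\<close>, equals
  \<open>2 ^ (n + 1 - k) - 1\<close> and depends on \<open>T\<close> alone.\<close>

lemma critical_tile_unique:
  assumes "critical_tile \<sigma> n k T" "critical_tile \<sigma>' n' k' T"
  shows "n' = n" "k' = k"
proof -
  have "tile \<sigma> n T" "tile \<sigma>' n' T"
    using assms by (auto simp: tile_def)
  then show n: "n' = n"
    by (rule tile_unique)
  have "k \<le> n" "k' \<le> n'"
    using assms by (auto simp: critical_tile_def)
  have "(2::int) ^ (n + 1 - k) = 2 ^ (n' + 1 - k')"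
    using cell_poly_critical[OF assms(1), of "1::int"] cell_poly_critical[OF assms(2), of "1::int"]
    by simp
  then have "n + 1 - k = n' + 1 - k'"
    using power_inject_exp[of "2::int"] by (metis one_less_numeral_iff semiring_norm(76))
  then show "k' = k"
    using n \<open>k \<le> n\<close> \<open>k' \<le> n'\<close> by linarith
qed

lemma basic_tile_order_le:
  assumes "basic_tile \<sigma> n k T"
  shows "k \<le> n + 1"
proof -
  obtain C B where "\<not> affine_dependent C" "card C = n + 1" "\<sigma> = convex hull C"
    "B \<subseteq> C" "card B = k" "T = convex hull C - (\<Union>A\<in>(\<lambda>v. C - {v}) ` B. convex hull A)"
    using basic_tileE[OF assms] .
  then show ?thesis
    using card_mono[OF aff_independent_finite, of C B] by simp
qed

text \<open>Cells are counted again, now \<open>2 ^ (n + 1 - k)\<close> of them. Positivity matters: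
  a point is a basic tile of orders \<open>0\<close> and \<open>1\<close>.\<close>

lemma basic_tile_unique:
  assumes "basic_tile \<sigma> n k T" "basic_tile \<sigma>' n' k' T" "0 < k" "0 < k'"
  shows "n' = n" "k' = k"
proof -
  have "tile \<sigma> n T" "tile \<sigma>' n' T"
    using assms by (auto simp: tile_def)
  then show n: "n' = n"
    by (rule tile_unique)
  have "k \<le> n + 1" "k' \<le> n' + 1"
    using assms basic_tile_order_le by blast+
  have "(2::int) ^ (n + 1 - k) = 2 ^ (n' + 1 - k')"
    using cell_poly_basic[OF assms(1), of "1::int"] cell_poly_basic[OF assms(2), of "1::int"] assms(3,4)
    by simp
  then have "n + 1 - k = n' + 1 - k'"
    using power_inject_exp[of "2::int"] by (metis one_less_numeral_iff semiring_norm(76))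
  then show "k' = k"
    using n \<open>k \<le> n + 1\<close> \<open>k' \<le> n' + 1\<close> by linarith
qed

text \<open>For index \<open>0\<close> the extra face to remove is the empty one, which changes
  nothing. Hence basic tiles that are not critical have positive order.\<close>

lemma closed_simplex_critical:
  assumes "basic_tile \<sigma> n 0 T"
  shows "critical_tile \<sigma> n 0 T"
proof -
  obtain \<F> where F: "\<F> \<subseteq> codim1_faces n \<sigma>" "card \<F> = 0" "T = \<sigma> - \<Union>\<F>" and s: "int n simplex \<sigma>"
    using assms unfolding basic_tile_def by auto
  obtain C B where C: "\<not> affine_dependent C" "card C = n + 1" "\<sigma> = convex hull C"
    "B \<subseteq> C" "card B = 0" "T = convex hull C - (\<Union>A\<in>(\<lambda>v. C - {v}) ` B. convex hull A)"
    using basic_tileE[OF assms] .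
  have "finite (codim1_faces n \<sigma>)"
    unfolding C(3) codim1_faces_simplex[OF C(1,2)] using aff_independent_finite[OF C(1)] by simp
  then have "\<F> = {}"
    using card_0_eq[OF finite_subset[OF F(1)]] F(2) by simp
  then show ?thesis
    using F s unfolding critical_tile_def by (intro conjI exI[of _ "{}"]) auto
qed

text \<open>Of the \<open>n + 1\<close> facets, all but one form the family of removed facets; the
  last one, opposite to an arbitrary vertex, is the face of dimension \<open>n - 1\<close> removed
  in addition.\<close>

lemma open_simplex_critical:
  assumes "basic_tile \<sigma> n (n + 1) T"
  shows "critical_tile \<sigma> n n T"
proof -
  obtain C B where C: "\<not> affine_dependent C" "card C = n + 1" "\<sigma> = convex hull C"
    "B \<subseteq> C" "card B = n + 1" "T = convex hull C - (\<Union>A\<in>(\<lambda>v. C - {v}) ` B. convex hull A)"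
    using basic_tileE[OF assms] .
  have "finite C" using C aff_independent_finite by blast
  then have "B = C" using C card_subset_eq by metis
  obtain v where v: "v \<in> C" using C by fastforce
  let ?f = "\<lambda>v. convex hull (C - {v})"
  let ?\<F> = "?f ` (C - {v})"
  have s: "int n simplex \<sigma>"
    using assms unfolding basic_tile_def by auto
  have "?\<F> \<subseteq> codim1_faces n \<sigma>" "?f v \<in> codim1_faces n \<sigma>"
    unfolding C(3) codim1_faces_simplex[OF C(1,2)] using v by auto
  moreover have "card ?\<F> = n"
    using card_image[OF inj_on_subset[OF inj_on_facet_opposite[OF C(1)], of "C - {v}"]] v C(2) by auto
  moreover have "\<forall>F\<in>?\<F>. \<not> ?f v \<subseteq> F"
    using convex_hull_subset_iff_affine_independent[OF C(1), of "C - {v}"] by auto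
  moreover have "T = \<sigma> - \<Union>?\<F> - ?f v"
    unfolding C(6) \<open>B = C\<close> C(3) using v by auto
  ultimately show ?thesis
    using s unfolding critical_tile_def codim1_faces_def
    by (intro conjI exI[of _ ?\<F>] exI[of _ "?f v"]) auto
qed

lemma has_order_critical:
  assumes "critical_tile \<sigma> n k T"
  shows "has_order T j \<longleftrightarrow> j = (if k < n then k else n + 1)"
proof -
  have "has_order T j \<longleftrightarrow> (\<exists>\<sigma> n k. critical_tile \<sigma> n k T \<and> j = (if k < n then k else n + 1))"
    unfolding has_order_def using assms by (intro if_P) blast
  also have "\<dots> \<longleftrightarrow> j = (if k < n then k else n + 1)"
  proof
    assume "\<exists>\<sigma> n k. critical_tile \<sigma> n k T \<and> j = (if k < n then k else n + 1)"
    then obtain \<sigma>' n' k' where *: "critical_tile \<sigma>' n' k' T" "j = (if k' < n' then k' else n' + 1)"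
      by blast
    show "j = (if k < n then k else n + 1)"
      using *(2) unfolding critical_tile_unique[OF assms *(1)] .
  qed (use assms in blast)
  finally show ?thesis .
qed

lemma has_order_basic:
  assumes "basic_tile \<sigma> n k T" "\<nexists>\<sigma> n k. critical_tile \<sigma> n k T"
  shows "has_order T j \<longleftrightarrow> j = k"
proof -
  \<comment> \<open>A presentation of order \<open>0\<close> would make the tile critical.\<close>
  have pos: "0 < k'" if "basic_tile \<sigma>' n' k' T" for \<sigma>' n' k'
    using that closed_simplex_critical assms(2) by (metis gr0I)
  have uniq: "j = k" if "basic_tile \<sigma>' n' j T" for \<sigma>' n'
    using basic_tile_unique(2)[OF assms(1) that pos[OF assms(1)] pos[OF that]] .
  have "has_order T j \<longleftrightarrow> (\<exists>\<sigma> n. basic_tile \<sigma> n j T)"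
    unfolding has_order_def using assms(2) by (rule if_not_P)
  also have "\<dots> \<longleftrightarrow> j = k"
  proof
    assume "\<exists>\<sigma> n. basic_tile \<sigma> n j T"
    then show "j = k" by (elim exE) (rule uniq)
  next
    assume "j = k"
    then show "\<exists>\<sigma> n. basic_tile \<sigma> n j T" using assms(1) by (intro exI) simp
  qed
  finally show ?thesis .
qed

text \<open>A critical tile has order \<open>n + 1\<close> at index \<open>n\<close> and an order
  below \<open>n\<close> otherwise; a basic tile of order \<open>n + 1\<close> is open and hence
  critical.\<close>

lemma has_order_top_iff_critical:
  assumes "tile \<sigma> n T"
  shows "has_order T (n + 1) \<longleftrightarrow> (\<exists>\<sigma> m. critical_tile \<sigma> m n T)"
proof (cases "\<exists>\<sigma> n k. critical_tile \<sigma> n k T")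
  case True
  then obtain \<sigma>' m k where k: "critical_tile \<sigma>' m k T" by blast
  then have "tile \<sigma>' m T" by (auto simp: tile_def)
  with assms have "m = n" by (rule tile_unique)
  have "k \<le> n" using k \<open>m = n\<close> by (simp add: critical_tile_def)
  have "(\<exists>\<sigma> m. critical_tile \<sigma> m n T) \<longleftrightarrow> k = n"
    using critical_tile_unique(2)[OF k] k by blast
  then show ?thesis
    using has_order_critical[OF k, of "n + 1"] \<open>m = n\<close> \<open>k \<le> n\<close> by auto
next
  case False
  then obtain k where "basic_tile \<sigma> n k T"
    using assms by (auto simp: tile_def)
  then show ?thesis
    using False has_order_basic open_simplex_critical by metis
qed

text \<open>A critical tile of index \<open>k < n\<close> lacks the term \<open>x ^ k\<close>, which
  the last sum restores. For index \<open>n\<close> the order \<open>n + 1\<close> already accounts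
  for the loss, as \<open>x ^ n * (x + 1) - x ^ n = x ^ (n + 1)\<close>; this is why that sum stops
  below \<open>n\<close>. The other tiles have positive order, so no empty face is missing.\<close>

lemma tile_contribution:
  fixes x :: "'b::comm_ring_1"
  assumes "tile \<sigma> n T"
  shows "(\<Sum>k | k \<in> {0..n + 1} \<and> has_order T k. x ^ k * (x + 1) ^ (n + 1 - k)) =
    cell_poly T x + (\<Sum>k | k \<in> {..<n} \<and> (\<exists>\<sigma> m. critical_tile \<sigma> m k T). x ^ k)"
proof (cases "\<exists>\<sigma> n k. critical_tile \<sigma> n k T")
  case True
  then obtain \<sigma>' m k where k: "critical_tile \<sigma>' m k T" by blast
  then have "tile \<sigma>' m T" by (auto simp: tile_def)
  with assms have "m = n" by (rule tile_unique)
  have "k \<le> n" using k \<open>m = n\<close> by (simp add: critical_tile_def)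
  have "(\<exists>\<sigma> m. critical_tile \<sigma> m k' T) \<longleftrightarrow> k' = k" for k'
    using critical_tile_unique(2)[OF k] k by blast
  then have "{k'. k' \<in> {..<n} \<and> (\<exists>\<sigma> m. critical_tile \<sigma> m k' T)} = (if k < n then {k} else {})"
    by auto
  moreover have "{j. j \<in> {0..n + 1} \<and> has_order T j} = {if k < n then k else n + 1}"
    using has_order_critical[OF k] \<open>m = n\<close> by auto
  ultimately show ?thesis
    using \<open>k \<le> n\<close> \<open>m = n\<close> by (simp add: cell_poly_critical[OF k] algebra_simps)
next
  case False
  then obtain k where k: "basic_tile \<sigma> n k T"
    using assms by (auto simp: tile_def)
  have "k \<noteq> 0"
    using k False closed_simplex_critical[of \<sigma> n T] by metis
  then have "0 < k" by simp
  have "{j. j \<in> {0..n + 1} \<and> has_order T j} = {k}"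
    unfolding has_order_basic[OF k False] using basic_tile_order_le[OF k] by auto
  moreover have "{k'. k' \<in> {..<n} \<and> (\<exists>\<sigma> m. critical_tile \<sigma> m k' T)} = {}"
    using False by auto
  ultimately show ?thesis
    using \<open>k \<noteq> 0\<close> by (simp only: cell_poly_basic[OF k]) simp
qed

section \<open>Simplices of a relative complex and the tiles that meet them\<close>

text \<open>\<open>\<rho> \<inter> \<sigma>\<close> is a face of \<open>\<rho>\<close> meeting its
  relative interior, hence all of \<open>\<rho>\<close>.\<close>

lemma simplicial_complex_carrier:
  assumes "simplicial_complex K" "\<rho> \<in> K" "\<sigma> \<in> K" "rel_interior \<rho> \<inter> \<sigma> \<noteq> {}"
  shows "\<rho> face_of \<sigma>"
proof -
  have "\<rho> \<inter> \<sigma> face_of \<rho>" "\<rho> \<inter> \<sigma> face_of \<sigma>"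
    using assms(1-3) unfolding simplicial_complex_def by (metis Int_commute)+
  moreover have "\<rho> \<inter> \<sigma> \<inter> rel_interior \<rho> \<noteq> {}"
    using assms(4) rel_interior_subset by blast
  ultimately show ?thesis
    using subset_of_face_of[of "\<rho> \<inter> \<sigma>" \<rho> \<rho>] by (metis inf.absorb1 inf.boundedE order_refl)
qed

text \<open>If the relative interior met a simplex of \<open>L\<close>, then \<open>\<rho>\<close>
  would be a face of it and so belong to \<open>L\<close>.\<close>

lemma rel_interior_subset_support:
  assumes "relative_complex K L" "\<rho> \<in> K - L"
  shows "rel_interior \<rho> \<subseteq> support K L"
proof -
  have "rel_interior \<rho> \<inter> \<nu> = {}" if "\<nu> \<in> L" for \<nu>
  proof (rule ccontr)
    assume "rel_interior \<rho> \<inter> \<nu> \<noteq> {}"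
    then have "\<rho> face_of \<nu>"
      using simplicial_complex_carrier[of K \<rho> \<nu>] assms that unfolding relative_complex_def by blast
    then show False
      using assms that unfolding relative_complex_def simplicial_complex_def by blast
  qed
  then show ?thesis
    using assms(2) rel_interior_subset unfolding support_def by blast
qed

lemma simplex_rel_interior_nonempty:
  assumes "simplicial_complex K" "\<rho> \<in> K" "\<rho> \<noteq> {}"
  shows "rel_interior \<rho> \<noteq> {}"
  using assms rel_interior_eq_empty convex_simplex unfolding simplicial_complex_def by metis

lemma subset_maximal_simplex:
  assumes "simplicial_complex K" "\<sigma> \<in> K"
  obtains \<mu> where "maximal_simplex K \<mu>" "\<sigma> \<subseteq> \<mu>"
proof -
  have "finite K" using assms unfolding simplicial_complex_def by blast
  then obtain \<mu> where "\<mu> \<in> K" "\<sigma> \<subseteq> \<mu>" "\<forall>\<nu>\<in>K. \<mu> \<subseteq> \<nu> \<longrightarrow> \<nu> = \<mu>"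
    using finite_has_maximal2[OF _ assms(2)] by metis
  then show ?thesis
    using that unfolding maximal_simplex_def by blast
qed

text \<open>
  The union of the \<open>n\<close>-dimensional tiles contains the relative interior of every maximal simplex,
  hence is dense in the support; as it is also closed there, no other tile is left.
\<close>

lemma h_tiling_tile_dim:
  assumes rel: "relative_complex K L" and pure: "pure_dim n K" and til: "h_tiling K L \<tau>"
    and T: "T \<in> \<tau>"
  obtains \<sigma> where "\<sigma> \<in> K" "tile \<sigma> n T"
proof -
  have K: "simplicial_complex K" using rel unfolding relative_complex_def by blast
  obtain \<sigma> m where \<sigma>: "\<sigma> \<in> K" "tile \<sigma> m T"
    using til T unfolding h_tiling_def by blast
  obtain \<mu> where \<mu>: "maximal_simplex K \<mu>" "\<sigma> \<subseteq> \<mu>"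
    using subset_maximal_simplex[OF K \<sigma>(1)] .
  then have \<mu>n: "int n simplex \<mu>" "\<mu> \<in> K" "\<mu> \<in> K - L"
    using pure rel unfolding pure_dim_def maximal_simplex_def relative_complex_def by auto
  have "int m \<le> int n"
    using aff_dim_subset[OF \<mu>(2)] aff_dim_simplex[OF \<mu>n(1)] aff_dim_simplex[OF tile_simplex(1)[OF \<sigma>(2)]]
    by simp
  moreover have "\<not> m < n"
  proof
    assume "m < n"
    \<comment> \<open>The truncated difference is harmless, since \<open>m < n\<close> gives
      \<open>0 < n\<close>: these are the tiles of dimension at least \<open>n\<close>.\<close>
    define U where "U = \<Union>{T \<in> \<tau>. \<exists>\<sigma> k. n - 1 < k \<and> tile \<sigma> k T}"
    have "closedin (top_of_set (support K L)) U"
      using til unfolding h_tiling_def U_def by blast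
    \<comment> \<open>\<open>\<mu>\<close> may leave the support, so its closure is taken inside an
      ambient closed set.\<close>
    then obtain D where D: "closed D" "U = support K L \<inter> D"
      unfolding closedin_closed by blast
    have "rel_interior \<mu> \<subseteq> U"
    proof
      fix y assume y: "y \<in> rel_interior \<mu>"
      then have "y \<in> \<Union>\<tau>"
        using rel_interior_subset_support[OF rel \<mu>n(3)] til unfolding h_tiling_def partition_on_def by blast
      then obtain T' where T': "T' \<in> \<tau>" "y \<in> T'" by blast
      then obtain \<sigma>' m' where \<sigma>': "\<sigma>' \<in> K" "tile \<sigma>' m' T'"
        using til unfolding h_tiling_def by blast
      then have "y \<in> \<sigma>'"
        using tile_simplex(4) T' by blast
      then have "\<mu> face_of \<sigma>'"
        using simplicial_complex_carrier[OF K \<mu>n(2) \<sigma>'(1)] y by blast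
      then have "\<sigma>' = \<mu>"
        using face_of_imp_subset \<mu>(1) \<sigma>'(1) unfolding maximal_simplex_def by blast
      then have "int m' = int n"
        using tile_simplex(1)[OF \<sigma>'(2)] \<mu>n(1) aff_dim_simplex by metis
      then have "n - 1 < m'"
        using \<open>m < n\<close> by simp
      then show "y \<in> U"
        unfolding U_def using T' \<sigma>'(2) by blast
    qed
    then have "closure (rel_interior \<mu>) \<subseteq> D"
      using D closure_minimal by blast
    then have "\<mu> \<subseteq> D"
      using convex_closure_rel_interior[OF convex_simplex[OF \<mu>n(1)]] closure_subset by blast
    moreover have "T \<subseteq> \<sigma>" using tile_simplex(4)[OF \<sigma>(2)] .
    moreover have "T \<subseteq> support K L"
      using til T unfolding h_tiling_def partition_on_def by blast
    ultimately have "T \<subseteq> U" using D(2) \<mu>(2) by blast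
    moreover have "T \<noteq> {}"
      using til T unfolding h_tiling_def partition_on_def by blast
    \<comment> \<open>A point of \<open>T\<close> lies in a tile of dimension at least
      \<open>n\<close>; by disjointness that tile is \<open>T\<close> itself, against
      \<open>m < n\<close>.\<close>
    ultimately obtain T' \<sigma>' k where T': "T' \<in> \<tau>" "n - 1 < k" "tile \<sigma>' k T'" "T \<inter> T' \<noteq> {}"
      unfolding U_def by blast
    then have "T' = T"
      using til T unfolding h_tiling_def partition_on_def disjoint_def by blast
    then have "k = m"
      using T' \<sigma>(2) tile_unique(2) by blast
    then show False using T' \<open>m < n\<close> by simp
  qed
  ultimately have "m = n" by simp
  with \<sigma> that show ?thesis by blast
qed

context
  fixes K L :: "'a::euclidean_space set set" and n :: nat and \<tau>
  assumes rel: "relative_complex K L" and pure: "pure_dim n K" and til: "h_tiling K L \<tau>"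
begin

lemma h_tiling_disjoint:
  assumes "T \<in> \<tau>" "T' \<in> \<tau>" "T \<inter> T' \<noteq> {}"
  shows "T = T'"
  using assms til unfolding h_tiling_def partition_on_def disjoint_def by blast

text \<open>Closures embed the tiles into the finite \<open>K\<close>: two tiles with the same
  closed simplex share its relative interior and so are not disjoint.\<close>

lemma h_tiling_finite: "finite \<tau>"
proof (rule inj_on_finite)
  show "inj_on closure \<tau>"
  proof (rule inj_onI)
    fix T T' assume T: "T \<in> \<tau>" "T' \<in> \<tau>" "closure T = closure T'"
    obtain \<sigma> where s: "tile \<sigma> n T" using h_tiling_tile_dim[OF rel pure til T(1)] .
    obtain \<sigma>' where s': "tile \<sigma>' n T'" using h_tiling_tile_dim[OF rel pure til T(2)] .
    have "\<sigma>' = \<sigma>" using T(3) tile_simplex(2)[OF s] tile_simplex(2)[OF s'] by simp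
    then have "rel_interior \<sigma> \<subseteq> T \<inter> T'"
      using tile_simplex(3)[OF s] tile_simplex(3)[OF s'] by blast
    moreover have "rel_interior \<sigma> \<noteq> {}"
      using tile_simplex(1)[OF s] rel_interior_eq_empty[OF convex_simplex] by fastforce
    ultimately show "T = T'"
      using h_tiling_disjoint T by blast
  qed
  show "closure ` \<tau> \<subseteq> K"
  proof
    fix \<rho> assume "\<rho> \<in> closure ` \<tau>"
    then obtain T where T: "T \<in> \<tau>" "\<rho> = closure T" by blast
    obtain \<sigma> where "\<sigma> \<in> K" "tile \<sigma> n T" using h_tiling_tile_dim[OF rel pure til T(1)] .
    then show "\<rho> \<in> K" using tile_simplex(2) T by blast
  qed
  show "finite K"
    using rel unfolding relative_complex_def simplicial_complex_def by blast
qed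

text \<open>A point in the relative interior of \<open>\<rho>\<close> lies in some tile, whose
  closed simplex then has \<open>\<rho>\<close> as a face, and \<open>tile_simplex(5)\<close> makes
  it a cell. Two tiles with a common cell would meet in its nonempty relative interior.\<close>

lemma cells_partition:
  shows "{\<rho> \<in> K - L. \<rho> \<noteq> {}} = (\<Union>T\<in>\<tau>. cells T)"
    and "\<And>T T'. T \<in> \<tau> \<Longrightarrow> T' \<in> \<tau> \<Longrightarrow> T \<noteq> T' \<Longrightarrow> cells T \<inter> cells T' = {}"
proof -
  have K: "simplicial_complex K" using rel unfolding relative_complex_def by blast
  have inK: "\<rho> \<in> K" if T: "T \<in> \<tau>" and \<rho>: "\<rho> \<in> cells T" for \<rho> T
  proof -
    obtain \<sigma> where \<sigma>: "\<sigma> \<in> K" "tile \<sigma> n T" using h_tiling_tile_dim[OF rel pure til T] .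
    then have "\<rho> face_of \<sigma>"
      using \<rho> tile_simplex(2) unfolding cells_def by blast
    then show ?thesis
      using K \<sigma> unfolding simplicial_complex_def by blast
  qed
  have ne: "rel_interior \<rho> \<noteq> {}" if "T \<in> \<tau>" "\<rho> \<in> cells T" for \<rho> T
    using simplex_rel_interior_nonempty[OF K inK[OF that]] that unfolding cells_def by blast
  show "{\<rho> \<in> K - L. \<rho> \<noteq> {}} = (\<Union>T\<in>\<tau>. cells T)"
  proof (intro subset_antisym subsetI)
    fix \<rho> assume \<rho>: "\<rho> \<in> {\<rho> \<in> K - L. \<rho> \<noteq> {}}"
    then obtain x where x: "x \<in> rel_interior \<rho>"
      using simplex_rel_interior_nonempty[OF K] by blast
    then have "x \<in> \<Union>\<tau>"
      using rel_interior_subset_support[OF rel] \<rho> til unfolding h_tiling_def partition_on_def by blast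
    then obtain T where T: "T \<in> \<tau>" "x \<in> T" by blast
    obtain \<sigma> where \<sigma>: "\<sigma> \<in> K" "tile \<sigma> n T" using h_tiling_tile_dim[OF rel pure til T(1)] .
    have "\<rho> face_of \<sigma>"
      using simplicial_complex_carrier[OF K _ \<sigma>(1), of \<rho>] \<rho> x T tile_simplex(4)[OF \<sigma>(2)] by blast
    then have "\<rho> \<in> cells T"
      using tile_simplex(5)[OF \<sigma>(2)] x T by blast
    then show "\<rho> \<in> (\<Union>T\<in>\<tau>. cells T)" using T by blast
  next
    fix \<rho> assume "\<rho> \<in> (\<Union>T\<in>\<tau>. cells T)"
    then obtain T where T: "T \<in> \<tau>" "\<rho> \<in> cells T" by blast
    have "rel_interior \<rho> \<subseteq> support K L"
      using T til unfolding cells_def h_tiling_def partition_on_def by blast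
    then have "\<rho> \<notin> L"
      using ne[OF T] rel_interior_subset[of \<rho>] unfolding support_def by blast
    then show "\<rho> \<in> {\<rho> \<in> K - L. \<rho> \<noteq> {}}"
      using inK[OF T] T unfolding cells_def by blast
  qed
  show "cells T \<inter> cells T' = {}" if "T \<in> \<tau>" "T' \<in> \<tau>" "T \<noteq> T'" for T T'
    using that ne h_tiling_disjoint[of T T'] unfolding cells_def by blast
qed

end

section \<open>Generating polynomials of faces, tiles and critical tiles\<close>

text \<open>Double counting of the pairs related by \<open>R\<close>; it passes from the numbers
  \<open>f_num\<close>, \<open>h_num\<close> and \<open>c_num\<close> to sums over simplices or
  tiles.\<close>

lemma sum_card_restrict:
  assumes "finite I" "finite A"
  shows "(\<Sum>k\<in>I. of_nat (card {a \<in> A. R a k}) * g k) =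
    (\<Sum>a\<in>A. \<Sum>k | k \<in> I \<and> R a k. g k :: 'b::comm_semiring_1)"
  using sum.swap_restrict[OF assms(2,1), of "\<lambda>a k. g k" R] by simp

text \<open>The factor \<open>x\<close> raises the exponent from the dimension to the number of
  vertices. Purity bounds all dimensions by \<open>n\<close>, so the range \<open>0..n\<close>
  misses no nonempty simplex.\<close>

lemma f_polynomial_eq_cells:
  fixes K L :: "'a::euclidean_space set set" and x :: "'b::comm_ring_1"
  assumes rel: "relative_complex K L" and pure: "pure_dim n K"
  shows "x * (\<Sum>k=0..n. of_nat (f_num K L k) * x ^ k) =
    (\<Sum>\<rho>\<in>{\<rho> \<in> K - L. \<rho> \<noteq> {}}. x ^ nat (aff_dim \<rho> + 1))"
proof -
  let ?A = "{\<rho> \<in> K - L. \<rho> \<noteq> {}}"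
  have K: "simplicial_complex K" using rel unfolding relative_complex_def by blast
  then have fin: "finite ?A" unfolding simplicial_complex_def by simp
  have f: "f_num K L k = card {\<rho> \<in> ?A. int k simplex \<rho>}" for k
  proof -
    have "{\<rho> \<in> K - L. int k simplex \<rho>} = {\<rho> \<in> ?A. int k simplex \<rho>}" by auto
    then show ?thesis unfolding f_num_def by simp
  qed
  have "x * (\<Sum>k=0..n. of_nat (f_num K L k) * x ^ k) = (\<Sum>k=0..n. of_nat (f_num K L k) * x ^ (k + 1))"
    by (simp add: sum_distrib_left algebra_simps)
  also have "\<dots> = (\<Sum>\<rho>\<in>?A. \<Sum>k | k \<in> {0..n} \<and> int k simplex \<rho>. x ^ (k + 1))"
    unfolding f by (rule sum_card_restrict) (use fin in auto)
  also have "\<dots> = (\<Sum>\<rho>\<in>?A. x ^ nat (aff_dim \<rho> + 1))"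
  proof (rule sum.cong)
    fix \<rho> assume \<rho>: "\<rho> \<in> ?A"
    then obtain m where m: "m simplex \<rho>" using K unfolding simplicial_complex_def by blast
    have "m \<noteq> -1" using m \<rho> by auto
    then have "0 \<le> m" using simplex_dim_ge[OF m] by simp
    then obtain k where k: "m = int k" using nonneg_int_cases by blast
    obtain \<mu> where \<mu>: "maximal_simplex K \<mu>" "\<rho> \<subseteq> \<mu>"
      using subset_maximal_simplex[OF K] \<rho> by blast
    then have "int k \<le> int n"
      using aff_dim_subset[OF \<mu>(2)] aff_dim_simplex[OF m] aff_dim_simplex[of "int n" \<mu>] pure k
      unfolding pure_dim_def by simp
    moreover have "int l simplex \<rho> \<longleftrightarrow> l = k" for l
      using m k aff_dim_simplex[of "int l" \<rho>] aff_dim_simplex[OF m] by auto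
    ultimately have "{k. k \<in> {0..n} \<and> int k simplex \<rho>} = {k}"
      by auto
    then show "(\<Sum>k | k \<in> {0..n} \<and> int k simplex \<rho>. x ^ (k + 1)) = x ^ nat (aff_dim \<rho> + 1)"
      using aff_dim_simplex[OF m] k by (simp add: nat_add_distrib)
  qed simp
  finally show ?thesis .
qed

text \<open>\<open>tile_contribution\<close> is summed over the tiles, whose cells partition the
  nonempty simplices outside \<open>L\<close>.\<close>

lemma h_polynomial_eq:
  fixes K L :: "'a::euclidean_space set set" and x :: "'b::comm_ring_1"
  assumes rel: "relative_complex K L" and pure: "pure_dim n K" and til: "h_tiling K L \<tau>"
  shows "(\<Sum>k=0..n + 1. of_nat (h_num \<tau> k) * x ^ k * (x + 1) ^ (n + 1 - k)) =
    x * (\<Sum>k=0..n. of_nat (f_num K L k) * x ^ k) + (\<Sum>k<n. of_nat (c_num \<tau> k) * x ^ k)"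
proof -
  have fin: "finite \<tau>" using h_tiling_finite[OF rel pure til] .
  have K: "finite K" using rel unfolding relative_complex_def simplicial_complex_def by blast
  note cells = cells_partition[OF rel pure til]
  have finc: "finite (cells T)" if "T \<in> \<tau>" for T
  proof (rule finite_subset)
    show "cells T \<subseteq> {\<rho> \<in> K - L. \<rho> \<noteq> {}}"
      unfolding cells(1) using that by blast
  qed (use K in simp)
  have "(\<Sum>k=0..n + 1. of_nat (h_num \<tau> k) * x ^ k * (x + 1) ^ (n + 1 - k)) =
    (\<Sum>T\<in>\<tau>. \<Sum>k | k \<in> {0..n + 1} \<and> has_order T k. x ^ k * (x + 1) ^ (n + 1 - k))"
    unfolding h_num_def mult.assoc by (rule sum_card_restrict) (use fin in auto)
  also have "\<dots> = (\<Sum>T\<in>\<tau>. cell_poly T x +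
    (\<Sum>k | k \<in> {..<n} \<and> (\<exists>\<sigma> m. critical_tile \<sigma> m k T). x ^ k))"
  proof (rule sum.cong)
    fix T assume "T \<in> \<tau>"
    then obtain \<sigma> where "tile \<sigma> n T" using h_tiling_tile_dim[OF rel pure til] by metis
    then show "(\<Sum>k | k \<in> {0..n + 1} \<and> has_order T k. x ^ k * (x + 1) ^ (n + 1 - k)) =
      cell_poly T x + (\<Sum>k | k \<in> {..<n} \<and> (\<exists>\<sigma> m. critical_tile \<sigma> m k T). x ^ k)"
      by (rule tile_contribution)
  qed simp
  also have "\<dots> = (\<Sum>T\<in>\<tau>. cell_poly T x) + (\<Sum>k<n. of_nat (c_num \<tau> k) * x ^ k)"
    unfolding c_num_def sum.distrib
    using sum_card_restrict[of "{..<n}" \<tau> "\<lambda>T k. \<exists>\<sigma> m. critical_tile \<sigma> m k T" "\<lambda>k. x ^ k"] fin by simp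
  also have "(\<Sum>T\<in>\<tau>. cell_poly T x) = x * (\<Sum>k=0..n. of_nat (f_num K L k) * x ^ k)"
    unfolding f_polynomial_eq_cells[OF rel pure] cells(1) cell_poly_def
    using fin finc cells(2) by (subst sum.UNION_disjoint) auto
  finally show ?thesis .
qed

text \<open>The polynomial identity involves only the indices \<open>k < n\<close>, so the last
  entry of the c-vector is recovered separately.\<close>

lemma c_num_top:
  assumes "relative_complex K L" "pure_dim n K" "h_tiling K L \<tau>"
  shows "c_num \<tau> n = h_num \<tau> (n + 1)"
proof -
  have "has_order T (n + 1) \<longleftrightarrow> (\<exists>\<sigma> m. critical_tile \<sigma> m n T)" if "T \<in> \<tau>" for T
    using h_tiling_tile_dim[OF assms that] has_order_top_iff_critical by metis
  then have "{T \<in> \<tau>. \<exists>\<sigma> m. critical_tile \<sigma> m n T} = {T \<in> \<tau>. has_order T (n + 1)}"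
    by blast
  then show ?thesis unfolding c_num_def h_num_def by simp
qed

section \<open>Linear independence of the polynomials\<close>

lemma of_nat_times_X_power: "of_nat m * [:0, 1:] ^ k = monom (of_nat m :: 'a::comm_semiring_1) k"
  unfolding monom_altdef of_nat_poly by simp

text \<open>The system is triangular: the coefficient of \<open>X ^ k * (X + 1) ^ (N - k)\<close> at
  degree \<open>j\<close> vanishes for \<open>k > j\<close> and is \<open>1\<close> for
  \<open>k = j\<close>.\<close>

lemma power_times_power_independent:
  fixes a b :: "nat \<Rightarrow> nat"
  defines "X \<equiv> [:0, 1:] :: int poly"
  assumes eq: "(\<Sum>k=0..N. of_nat (a k) * X ^ k * (X + 1) ^ (N - k)) =
    (\<Sum>k=0..N. of_nat (b k) * X ^ k * (X + 1) ^ (N - k))"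
    and "j \<le> N"
  shows "a j = b j"
  using \<open>j \<le> N\<close>
proof (induction j rule: less_induct)
  case (less j)
  define t where "t c k = coeff (of_nat (c k) * X ^ k * (X + 1) ^ (N - k)) j" for c :: "nat \<Rightarrow> nat" and k
  have t: "t c k = (if j < k then 0 else int (c k) * coeff ((X + 1) ^ (N - k)) (j - k))" for c k
    unfolding t_def X_def of_nat_times_X_power by (simp add: coeff_monom_mult)
  have "(\<Sum>k=0..N. t a k) = (\<Sum>k=0..N. t b k)"
    using arg_cong[OF eq, of "\<lambda>p. coeff p j"] unfolding t_def coeff_sum .
  \<comment> \<open>Terms with \<open>k > j\<close> vanish; those with \<open>k < j\<close> agree by
    the induction hypothesis.\<close>
  moreover have "(\<Sum>k\<in>{0..N} - {j}. t a k) = (\<Sum>k\<in>{0..N} - {j}. t b k)"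
    by (rule sum.cong) (use less in \<open>auto simp: t\<close>)
  ultimately have "t a j = t b j"
    using less.prems by (simp add: sum.remove[of "{0..N}" j])
  moreover have "coeff ((X + 1) ^ (N - j)) 0 = 1"
    by (simp add: coeff_0_power X_def)
  ultimately show ?case
    by (simp add: t)
qed

lemma power_independent:
  fixes a b :: "nat \<Rightarrow> nat"
  defines "X \<equiv> [:0, 1:] :: int poly"
  assumes eq: "(\<Sum>k<n. of_nat (a k) * X ^ k) = (\<Sum>k<n. of_nat (b k) * X ^ k)" and "j < n"
  shows "a j = b j"
proof -
  have "coeff (\<Sum>k<n. of_nat (c k) * X ^ k) j = int (c j)" for c :: "nat \<Rightarrow> nat"
    unfolding X_def of_nat_times_X_power using \<open>j < n\<close> by (simp add: coeff_sum)
  then show ?thesis using eq by (metis of_nat_eq_iff)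
qed

theorem theorem1p6:
  fixes K L :: "'a::euclidean_space set set" and n :: nat
  assumes "relative_complex K L" and "pure_dim n K"
  shows "(\<forall>\<tau>. h_tiling K L \<tau> \<longrightarrow>
            (let X = [:0, 1:] :: int poly in
              (\<Sum>k=0..n+1. of_nat (h_num \<tau> k) * X ^ k * (X + 1) ^ (n + 1 - k)) =
              X * (\<Sum>k=0..n. of_nat (f_num K L k) * X ^ k) +
              (\<Sum>k<n. of_nat (c_num \<tau> k) * X ^ k))) \<and>
         (\<forall>\<tau> \<tau>'. h_tiling K L \<tau> \<and> h_tiling K L \<tau>' \<longrightarrow>
            ((\<forall>j\<in>{0..n+1}. h_num \<tau> j = h_num \<tau>' j) \<longleftrightarrow>
             (\<forall>j\<in>{0..n}. c_num \<tau> j = c_num \<tau>' j)))"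
proof (intro conjI allI impI)
  fix \<tau> assume "h_tiling K L \<tau>"
  then show "let X = [:0, 1:] :: int poly in
      (\<Sum>k=0..n+1. of_nat (h_num \<tau> k) * X ^ k * (X + 1) ^ (n + 1 - k)) =
      X * (\<Sum>k=0..n. of_nat (f_num K L k) * X ^ k) + (\<Sum>k<n. of_nat (c_num \<tau> k) * X ^ k)"
    unfolding Let_def by (rule h_polynomial_eq[OF assms])
next
  fix \<tau> \<tau>' assume "h_tiling K L \<tau> \<and> h_tiling K L \<tau>'"
  then have til: "h_tiling K L \<tau>" "h_tiling K L \<tau>'" by blast+
  let ?X = "[:0, 1:] :: int poly"
  note eqs = h_polynomial_eq[OF assms til(1), of ?X] h_polynomial_eq[OF assms til(2), of ?X]
  show "(\<forall>j\<in>{0..n+1}. h_num \<tau> j = h_num \<tau>' j) \<longleftrightarrow> (\<forall>j\<in>{0..n}. c_num \<tau> j = c_num \<tau>' j)"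
  proof
    assume h: "\<forall>j\<in>{0..n+1}. h_num \<tau> j = h_num \<tau>' j"
    then have "(\<Sum>k=0..n+1. of_nat (h_num \<tau> k) * ?X ^ k * (?X + 1) ^ (n + 1 - k)) =
        (\<Sum>k=0..n+1. of_nat (h_num \<tau>' k) * ?X ^ k * (?X + 1) ^ (n + 1 - k))"
      by (intro sum.cong) auto
    \<comment> \<open>The two identities share their \<open>f_num\<close> part, which
      cancels.\<close>
    then have "(\<Sum>k<n. of_nat (c_num \<tau> k) * ?X ^ k) = (\<Sum>k<n. of_nat (c_num \<tau>' k) * ?X ^ k)"
      unfolding eqs by (rule add_left_imp_eq)
    then have "c_num \<tau> j = c_num \<tau>' j" if "j < n" for j
      using power_independent[of "c_num \<tau>" n "c_num \<tau>'" j] that by blast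
    \<comment> \<open>The top entry does not occur in the identity; it equals \<open>h_num\<close>
      at \<open>n + 1\<close>.\<close>
    moreover have "c_num \<tau> n = c_num \<tau>' n"
      using h c_num_top[OF assms til(1)] c_num_top[OF assms til(2)] by simp
    ultimately show "\<forall>j\<in>{0..n}. c_num \<tau> j = c_num \<tau>' j"
      by (metis atLeastAtMost_iff le_neq_implies_less)
  next
    assume "\<forall>j\<in>{0..n}. c_num \<tau> j = c_num \<tau>' j"
    then have "(\<Sum>k<n. of_nat (c_num \<tau> k) * ?X ^ k) = (\<Sum>k<n. of_nat (c_num \<tau>' k) * ?X ^ k)"
      by (intro sum.cong) auto
    then have "(\<Sum>k=0..n+1. of_nat (h_num \<tau> k) * ?X ^ k * (?X + 1) ^ (n + 1 - k)) =
        (\<Sum>k=0..n+1. of_nat (h_num \<tau>' k) * ?X ^ k * (?X + 1) ^ (n + 1 - k))"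
      unfolding eqs by simp
    then have "h_num \<tau> j = h_num \<tau>' j" if "j \<le> n + 1" for j
      using that by (rule power_times_power_independent)
    then show "\<forall>j\<in>{0..n+1}. h_num \<tau> j = h_num \<tau>' j" by simp
  qed
qed

end
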